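(* Let $\gamma$ be the standard Gaussian measure on $\mathbb{R}^n$. For all convex sets $K,L\subset\mathbb{R}^n$ which contain the origin, and every $\lambda\in[0,1]$, $$\gamma(\lambda K+(1-\lambda)L)^{\frac{1}{2n}}\geq \lambda\,\gamma(K)^{\frac{1}{2n}}+(1-\lambda)\,\gamma(L)^{\frac{1}{2n}}.$$
   Context: The standard Gaussian measure $\gamma$ on $\mathbb{R}^n$ has density $(2\pi)^{-n/2}e^{-|x|^2/2}$ with respect to Lebesgue measure. The Minkowski combination is $\lambda K+(1-\lambda)L=\{\lambda x+(1-\lambda)y: x\in K,\ y\in L\}$. *)

theory Defs
  imports "HOL-Analysis.Analysis"
begin

(* The base measure is lebesgue rather than lborel because convex sets are always Lebesgue
   measurable but need not be Borel, and measure M A = 0 when A is not in sets M. *)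
definition std_gaussian :: "(real ^ 'n) measure" where
  "std_gaussian = density lebesgue
     (\<lambda>x. ennreal ((2 * pi) powr (- real CARD('n) / 2) * exp (- (norm x)\<^sup>2 / 2)))"

definition minkowski_comb :: "real \<Rightarrow> (real ^ 'n) set \<Rightarrow> (real ^ 'n) set \<Rightarrow> (real ^ 'n) set" where
  "minkowski_comb t K L = {t *\<^sub>R x + (1 - t) *\<^sub>R y | x y. x \<in> K \<and> y \<in> L}"

end

theory Submission
  imports Defs "HOL-Probability.Distributions"
begin

text \<open>
  Write \<open>I A U\<close> for the integral of \<open>exp (- A |x|\<^sup>2 / 2)\<close> over \<open>U\<close> and \<open>a\<^sup>2\<close>, \<open>b\<^sup>2\<close> for the mean of
  \<open>|x|\<^sup>2\<close> under the Gaussian measure restricted to \<open>K\<close>, \<open>L\<close> and normalised. Since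
  \<open>|t x + (1 - t) y|\<^sup>2 \<le> m (t |x|\<^sup>2 / a + (1 - t) |y|\<^sup>2 / b)\<close> with \<open>m = t a + (1 - t) b\<close>, the
  Prekopa-Leindler inequality bounds \<open>I 1 (t K + (1 - t) L)\<close> from below by a geometric mean of
  \<open>I A K\<close> and \<open>I B L\<close> for suitable \<open>A\<close>, \<open>B\<close>, and by Jensen's inequality
  \<open>I A K \<ge> I 1 K * exp (- (A - 1) a\<^sup>2 / 2)\<close>. After optimising the weight of the geometric mean, with
  \<open>p\<close>, \<open>q\<close> the \<open>2n\<close>-th roots of \<open>I 1 K\<close>, \<open>I 1 L\<close> and \<open>a = \<surd>n x\<close>, \<open>b = \<surd>n y\<close>, it remains to show
  \<open>(t p + (1 - t) q)\<^sup>2 \<le> (t p\<^sup>2 exp (x\<^sup>2/2) + (1 - t) q\<^sup>2 exp (y\<^sup>2/2)) * exp (- (t x + (1 - t) y)\<^sup>2/2)\<close>.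
  This is the Cauchy-Schwarz inequality together with the concavity of \<open>exp (- x\<^sup>2/2)\<close> on \<open>[0,1]\<close>.
  The origin enters only through \<open>x, y \<le> 1\<close>: for \<open>s \<le> 1\<close> we have \<open>s K \<subseteq> K\<close>, so
  \<open>s\<^sup>n I (s\<^sup>2) K \<le> I 1 K\<close>, and Jensen's inequality and \<open>s \<rightarrow> 1\<close> give \<open>a\<^sup>2 \<le> n\<close>.
\<close>

section \<open>The Prekopa-Leindler inequality\<close>

text \<open>Levels are rescaled to \<open>u\<close> in (0,1) so that the layers of several
  functions, each measured relative to its own maximum, can be compared at the same
  \<open>u\<close>; the price is the truncation at \<open>m\<close>. The formula is Tonelli's
  theorem for the set of pairs with \<open>m * u\<close> at most \<open>f x\<close>.\<close>

lemma layer_cake: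
  fixes f :: "'a \<Rightarrow> ennreal"
  assumes M: "sigma_finite_measure M" and [measurable]: "f \<in> borel_measurable M" and m: "0 < m"
  shows "(\<integral>\<^sup>+x. min (f x) (ennreal m) \<partial>M) =
    ennreal m * (\<integral>\<^sup>+u\<in>{0<..<1}. emeasure M {x\<in>space M. ennreal (m * u) \<le> f x} \<partial>lborel)"
proof -
  interpret M: sigma_finite_measure M by fact
  interpret P: pair_sigma_finite lborel M ..
  \<comment> \<open>For fixed \<open>x\<close> the admissible \<open>u\<close> form an interval with
    left end 0, whose length is the truncated value divided by \<open>m\<close>.\<close>
  have inner: "(\<integral>\<^sup>+u. indicator {0<..<1} u * indicator {u. ennreal (m * u) \<le> f x} u \<partial>lborel)
      = min (f x) (ennreal m) / ennreal m" for x
  proof (cases "f x")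
    case (real v)
    have "ennreal (m * u) \<le> f x \<longleftrightarrow> u \<le> v / m" for u
      unfolding real(2) ennreal_le_iff[OF real(1)] using m by (simp add: pos_le_divide_eq mult.commute)
    then have "{0<..<1} \<inter> {u. ennreal (m * u) \<le> f x} = {0<..<1} \<inter> {..v / m}"
      by auto
    also have "\<dots> = (if v / m < 1 then {0<..v / m} else {0<..<1})"
      by auto
    also have "\<dots> = (if v < m then {0<..v / m} else {0<..<1})"
      using m by simp
    finally have eq: "{0<..<1} \<inter> {u. ennreal (m * u) \<le> f x} = \<dots>" .
    have "emeasure lborel ({0<..<1} \<inter> {u. ennreal (m * u) \<le> f x}) = min (f x) (ennreal m) / ennreal m"
    proof (cases "v < m")
      case True
      then have "min (f x) (ennreal m) / ennreal m = ennreal (v / m)"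
        using m real by (simp add: min_absorb1 divide_ennreal)
      then show ?thesis unfolding eq using True real(1) m by simp
    next
      case False
      then have "min (f x) (ennreal m) / ennreal m = 1"
        using m unfolding real(2) by (simp add: min_absorb2 divide_ennreal)
      then show ?thesis unfolding eq using False by simp
    qed
    moreover have "{0<..<1} \<inter> {u. ennreal (m * u) \<le> f x} \<in> sets lborel" by measurable
    ultimately show ?thesis
      by (simp flip: indicator_inter_arith)
  next
    case top
    then show ?thesis using m by (simp add: divide_ennreal)
  qed
  have "(\<integral>\<^sup>+u\<in>{0<..<1}. emeasure M {x\<in>space M. ennreal (m * u) \<le> f x} \<partial>lborel)
      = (\<integral>\<^sup>+u. \<integral>\<^sup>+x. indicator {0<..<1} u * indicator {u. ennreal (m * u) \<le> f x} u \<partial>M \<partial>lborel)"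
  proof (intro nn_integral_cong)
    fix u :: real
    have "(\<integral>\<^sup>+x. indicator {0<..<1} u * indicator {u. ennreal (m * u) \<le> f x} u \<partial>M)
      = (\<integral>\<^sup>+x. indicator {0<..<1} u * indicator {x\<in>space M. ennreal (m * u) \<le> f x} x \<partial>M)"
      by (intro nn_integral_cong) (auto simp: indicator_def)
    also have "\<dots> = indicator {0<..<1} u * emeasure M {x\<in>space M. ennreal (m * u) \<le> f x}"
      by (subst nn_integral_cmult) auto
    finally show "emeasure M {x\<in>space M. ennreal (m * u) \<le> f x} * indicator {0<..<1} u
      = (\<integral>\<^sup>+x. indicator {0<..<1} u * indicator {u. ennreal (m * u) \<le> f x} u \<partial>M)"
      by (simp add: mult.commute)
  qed
  also have "\<dots> = (\<integral>\<^sup>+x. \<integral>\<^sup>+u. indicator {0<..<1} u * indicator {u. ennreal (m * u) \<le> f x} u \<partial>lborel \<partial>M)"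
    by (rule P.Fubini'[symmetric]) (simp add: indicator_def)
  also have "\<dots> = (\<integral>\<^sup>+x. min (f x) (ennreal m) \<partial>M) / ennreal m"
    unfolding inner by (rule nn_integral_divide) simp
  finally show ?thesis
    using m by (simp add: ennreal_times_divide mult.commute[of "ennreal m"] mult_divide_eq_ennreal)
qed

section \<open>The Brunn-Minkowski inequality on the real line\<close>

text \<open>The cut points have to lie in \<open>A\<close>, because
  \<open>brunn_minkowski_real\<close> uses them as summands. If \<open>A\<close> is unbounded above,
  points of \<open>A\<close> overtake every integer. Otherwise its supremum is a single null point,
  and whatever lies \<open>1 / (n + 1)\<close> below the supremum lies below a point of
  \<open>A\<close>.\<close>

lemma emeasure_eq_SUP_atMost:
  fixes A :: "real set"
  assumes A: "A \<in> sets borel" "A \<noteq> {}"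
  shows "emeasure lborel A = (SUP a\<in>A. emeasure lborel (A \<inter> {..a}))"
proof (rule antisym)
  let ?S = "SUP a\<in>A. emeasure lborel (A \<inter> {..a})"
  have le: "emeasure lborel (A \<inter> {..x}) \<le> ?S" if "a \<in> A" "x \<le> a" for a x
    using that A by (intro SUP_upper2[of a] emeasure_mono) auto
  show "emeasure lborel A \<le> ?S"
  proof (cases "bdd_above A")
    case False
    have "emeasure lborel A = (SUP n. emeasure lborel (A \<inter> {..real n}))"
      using A by (subst SUP_emeasure_incseq)
        (auto simp: incseq_def intro!: arg_cong[where f="emeasure lborel"] real_arch_simple)
    also have "\<dots> \<le> ?S"
    proof (rule SUP_least)
      fix n :: nat
      obtain a where "a \<in> A" "real n \<le> a" using False by (metis bdd_aboveI linorder_linear)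
      then show "emeasure lborel (A \<inter> {..real n}) \<le> ?S" by (rule le)
    qed
    finally show ?thesis .
  next
    case True
    define \<sigma> where "\<sigma> = Sup A"
    have "emeasure lborel A = emeasure lborel (A \<inter> {..<\<sigma>})"
    proof (rule emeasure_eq_AE)
      have "AE x in lborel. x \<noteq> \<sigma>"
        by (rule AE_lborel_singleton)
      then show "AE x in lborel. x \<in> A \<longleftrightarrow> x \<in> A \<inter> {..<\<sigma>}"
        by eventually_elim (auto simp: \<sigma>_def less_le intro: cSup_upper True)
    qed (use A in auto)
    also have "A \<inter> {..<\<sigma>} = (\<Union>n. A \<inter> {..\<sigma> - 1 / real (Suc n)})"
    proof -
      have "\<exists>n. x \<le> \<sigma> - 1 / real (Suc n)" if "x < \<sigma>" for x
        using nat_approx_posE[of "\<sigma> - x"] that by (metis add.commute diff_gt_0_iff_gt le_diff_eq less_eq_real_def)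
      moreover have "x < \<sigma>" if "x \<le> \<sigma> - 1 / real (Suc n)" for x n
        using that by (smt (verit) of_nat_0_less_iff zero_less_Suc zero_less_divide_1_iff)
      ultimately show ?thesis by blast
    qed
    also have "emeasure lborel \<dots> = (SUP n. emeasure lborel (A \<inter> {..\<sigma> - 1 / real (Suc n)}))"
    proof (rule SUP_emeasure_incseq[symmetric])
      have "1 / real (Suc n) \<le> 1 / real (Suc m)" if "m \<le> n" for m n
        using that by (simp add: field_simps)
      then show "incseq (\<lambda>n. A \<inter> {..\<sigma> - 1 / real (Suc n)})"
        by (force simp: incseq_def)
    qed (use A in auto)
    also have "\<dots> \<le> ?S"
    proof (rule SUP_least)
      fix n
      have "\<sigma> - 1 / real (Suc n) < \<sigma>" by simp
      then obtain a where "a \<in> A" "\<sigma> - 1 / real (Suc n) < a"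
        unfolding \<sigma>_def using less_cSup_iff[OF A(2) True] by blast
      then show "emeasure lborel (A \<inter> {..\<sigma> - 1 / real (Suc n)}) \<le> ?S" 
        by (intro le) auto
    qed
    finally show ?thesis .
  qed
qed (use A in \<open>auto intro!: SUP_least emeasure_mono\<close>)

lemma emeasure_lborel_uminus:
  fixes A :: "real set"
  assumes "A \<in> sets borel"
  shows "emeasure lborel (uminus -` A) = emeasure lborel A"
  using emeasure_distr[of uminus lborel borel A] assms by (simp add: lborel_distr_uminus)

lemma emeasure_eq_SUP_atLeast:
  fixes A :: "real set"
  assumes A: "A \<in> sets borel" "A \<noteq> {}"
  shows "emeasure lborel A = (SUP a\<in>A. emeasure lborel (A \<inter> {a..}))"
proof -
  have "uminus -` A \<inter> space borel \<in> sets borel"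
    using A(1) by (intro measurable_sets[of uminus borel borel]) auto
  then have sets: "uminus -` A \<in> sets borel" by simp
  obtain x where "x \<in> A" using A(2) by auto
  then have "- x \<in> uminus -` A" by simp
  then have ne: "uminus -` A \<noteq> {}" by blast
  have "emeasure lborel A = emeasure lborel (uminus -` A)"
    by (rule emeasure_lborel_uminus[symmetric, OF A(1)])
  also have "\<dots> = (SUP a\<in>uminus -` A. emeasure lborel ((uminus -` A) \<inter> {..a}))"
    by (rule emeasure_eq_SUP_atMost[OF sets ne])
  also have "\<dots> = (SUP a\<in>uminus -` A. emeasure lborel (A \<inter> {-a..}))"
  proof (intro SUP_cong refl)
    fix a
    have "(uminus -` A) \<inter> {..a} = uminus -` (A \<inter> {-a..})" by auto
    then show "emeasure lborel ((uminus -` A) \<inter> {..a}) = emeasure lborel (A \<inter> {-a..})"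
      using A(1) by (simp only: emeasure_lborel_uminus sets.Int atLeast_borel)
  qed
  also have "\<dots> = (SUP a\<in>A. emeasure lborel (A \<inter> {a..}))"
  proof -
    have "surj (uminus :: real \<Rightarrow> real)" by (metis surj_def minus_minus)
    then have "uminus ` (uminus -` A) = A" by (rule surj_image_vimage_eq)
    then have "(SUP a\<in>uminus ` (uminus -` A). emeasure lborel (A \<inter> {a..})) = (SUP a\<in>A. emeasure lborel (A \<inter> {a..}))"
      by (simp only:)
    then show ?thesis by (simp only: image_image)
  qed
  finally show ?thesis .
qed

lemma emeasure_lborel_affine:
  fixes A :: "real set"
  assumes A[measurable]: "A \<in> sets borel" and c: "0 < c"
  shows "(\<lambda>x. e + c * x) ` A \<in> sets borel"
    and "emeasure lborel ((\<lambda>x. e + c * x) ` A) = ennreal c * emeasure lborel A"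
proof -
  have eq: "(\<lambda>x. e + c * x) ` A = (\<lambda>z. (z - e) / c) -` A"
    using c by (force simp: image_iff field_simps)
  have "(\<lambda>z. (z - e) / c) -` A \<inter> space borel \<in> sets borel" by measurable
  then show 1[measurable]: "(\<lambda>x. e + c * x) ` A \<in> sets borel" by (simp add: eq)
  have "emeasure lborel ((\<lambda>x. e + c * x) ` A) = (\<integral>\<^sup>+x. indicator ((\<lambda>x. e + c * x) ` A) x \<partial>lborel)"
    by simp
  also have "\<dots> = ennreal \<bar>c\<bar> * (\<integral>\<^sup>+x. indicator ((\<lambda>x. e + c * x) ` A) (e + c * x) \<partial>lborel)"
    using c by (intro nn_integral_real_affine) auto
  also have "(\<lambda>x. indicator ((\<lambda>x. e + c * x) ` A) (e + c * x)) = (indicator A :: real \<Rightarrow> ennreal)"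
    using c by (auto simp: indicator_def fun_eq_iff)
  finally show "emeasure lborel ((\<lambda>x. e + c * x) ` A) = ennreal c * emeasure lborel A"
    using c by simp
qed

text \<open>For \<open>a\<close> in \<open>A\<close> and \<open>b\<close> in \<open>B\<close>, the
  part of \<open>A\<close> below \<open>a\<close> shifted by \<open>d * b\<close> and the part of
  \<open>B\<close> above \<open>b\<close> shifted by \<open>c * a\<close> both lie in
  \<open>C\<close> after scaling, and they meet at most in the point \<open>c * a + d * b\<close>.
  So their lengths add up; the suprema over \<open>a\<close> and \<open>b\<close> then exhaust
  \<open>A\<close> and \<open>B\<close>. A Borel superset \<open>C\<close> replaces the sum set,
  which need not be Borel.\<close>

lemma brunn_minkowski_real:
  fixes A B C :: "real set"
  assumes A[measurable]: "A \<in> sets borel" and B[measurable]: "B \<in> sets borel"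
    and C[measurable]: "C \<in> sets borel"
    and ne: "A \<noteq> {}" "B \<noteq> {}" and cd: "0 < c" "0 < d"
    and sub_C: "\<And>x y. x \<in> A \<Longrightarrow> y \<in> B \<Longrightarrow> c * x + d * y \<in> C"
  shows "ennreal c * emeasure lborel A + ennreal d * emeasure lborel B \<le> emeasure lborel C"
proof -
  let ?A = "\<lambda>a. emeasure lborel (A \<inter> {..a})" and ?B = "\<lambda>b. emeasure lborel (B \<inter> {b..})"
  have 1: "ennreal c * ?A a + ennreal d * ?B b \<le> emeasure lborel C" if ab: "a \<in> A" "b \<in> B" for a b
  proof -
    let ?X = "(\<lambda>x. d * b + c * x) ` (A \<inter> {..a})" and ?Y = "(\<lambda>y. c * a + d * y) ` (B \<inter> {b..})"
    have sets: "?X \<in> sets borel" "?Y \<in> sets borel"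
      using cd by (auto intro!: emeasure_lborel_affine(1))
    have "x \<le> c * a + d * b" if "x \<in> ?X" for x using that cd by auto
    moreover have "x \<ge> c * a + d * b" if "x \<in> ?Y" for x using that cd by auto
    ultimately have sub: "?X \<inter> ?Y \<subseteq> {c * a + d * b}" by force
    have "?X \<inter> ?Y \<in> sets lborel" using sets by (simp add: sets.Int)
    then have "?X \<inter> ?Y \<in> null_sets lborel"
      by (rule null_sets_subset[OF finite_imp_null_set_lborel _ sub, rotated]) simp
    then have "emeasure lborel ?X + emeasure lborel ?Y = emeasure lborel (?X \<union> ?Y)"
      using sets by (simp add: emeasure_Un')
    also have "\<dots> \<le> emeasure lborel C"
    proof (rule emeasure_mono)
      show "?X \<union> ?Y \<subseteq> C"
        using ab sub_C by (auto simp: add.commute[of "d * b"])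
    qed simp
    finally show ?thesis
      using cd by (simp add: emeasure_lborel_affine)
  qed
  have "ennreal c * emeasure lborel A + ennreal d * emeasure lborel B
      = (SUP b\<in>B. SUP a\<in>A. ennreal c * ?A a + ennreal d * ?B b)"
    using ne A B by (simp add: emeasure_eq_SUP_atMost[of A] emeasure_eq_SUP_atLeast[of B]
        SUP_mult_left_ennreal ennreal_SUP_add_left ennreal_SUP_add_right)
  also have "\<dots> \<le> emeasure lborel C"
    by (intro SUP_least 1)
  finally show ?thesis .
qed

section \<open>The Prekopa-Leindler inequality on the real line\<close>

text \<open>Brunn-Minkowski needs nonempty superlevel sets. A simple minorant attains its maximum
  \<open>a\<close>, so its superlevel sets at all levels \<open>a * u\<close> with
  \<open>u < 1\<close> contain \<open>x0\<close>.\<close>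

lemma nn_integral_less_simple_attaining_max:
  assumes "space M \<noteq> {}" and r: "r < (\<integral>\<^sup>+x. f x \<partial>M)"
  obtains \<phi> a x0 where "\<phi> \<in> borel_measurable M" "\<And>x. \<phi> x \<le> f x" "0 < a" "x0 \<in> space M" "\<phi> x0 = ennreal a"
    "\<And>x. x \<in> space M \<Longrightarrow> \<phi> x \<le> ennreal a" "r < (\<integral>\<^sup>+x. \<phi> x \<partial>M)"
proof -
  obtain \<phi> where \<phi>: "simple_function M \<phi>" "\<phi> \<le> f" "\<And>x. \<phi> x < top" "r < integral\<^sup>S M \<phi>"
    using r unfolding nn_integral_def_finite less_SUP_iff by auto
  define m where "m = Max (\<phi> ` space M)"
  have fin: "finite (\<phi> ` space M)" "\<phi> ` space M \<noteq> {}"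
    using \<phi>(1) assms(1) by (auto simp: simple_function_def)
  obtain x0 where x0: "x0 \<in> space M" "\<phi> x0 = m"
    using Max_in[OF fin] unfolding m_def by auto
  have le: "\<phi> x \<le> m" if "x \<in> space M" for x
    using that fin unfolding m_def by simp
  have int: "r < (\<integral>\<^sup>+x. \<phi> x \<partial>M)"
    using \<phi> by (simp add: nn_integral_eq_simple_integral)
  have "m \<noteq> 0"
  proof
    assume "m = 0"
    then have "(\<integral>\<^sup>+x. \<phi> x \<partial>M) = (\<integral>\<^sup>+x. 0 \<partial>M)" using le by (intro nn_integral_cong) force
    with int show False by simp
  qed
  moreover have "m < top" using x0 \<phi>(3) by metis
  ultimately have "m = ennreal (enn2real m)" "0 < enn2real m"
    by (auto simp: enn2real_positive_iff zero_less_iff_neq_zero)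
  then show thesis
    using that[of \<phi> "enn2real m" x0] \<phi> x0 le int borel_measurable_simple_function[OF \<phi>(1)]
    by (auto simp: le_fun_def)
qed

text \<open>Brunn-Minkowski is applied to the superlevel sets of simple minorants of
  \<open>f\<close> and \<open>g\<close>, integrated over the common relative level \<open>u\<close>,
  and followed by the weighted AM-GM inequality. The weight \<open>s\<close> is not tied to
  \<open>c\<close> and \<open>d\<close>, which produces the factor in \<open>c / s\<close> and
  \<open>d / (1 - s)\<close>; \<open>k\<close> carries the factors collected from other
  coordinates.\<close>

lemma prekopa_leindler_real_aux:
  fixes f g h :: "real \<Rightarrow> ennreal"
  assumes [measurable]: "h \<in> borel_measurable borel"
    and pos: "0 < c" "0 < d" "0 < s" "s < 1" "0 < k"
    and H: "\<And>x y r q. 0 < r \<Longrightarrow> 0 < q \<Longrightarrow> ennreal r \<le> f x \<Longrightarrow> ennreal q \<le> g y \<Longrightarrow>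
      ennreal (k * (r powr s * q powr (1 - s))) \<le> h (c * x + d * y)"
    and rq: "0 < r" "0 < q" "ennreal r < (\<integral>\<^sup>+x. f x \<partial>lborel)" "ennreal q < (\<integral>\<^sup>+x. g x \<partial>lborel)"
  shows "ennreal (k * ((c / s) powr s * (d / (1 - s)) powr (1 - s)) * (r powr s * q powr (1 - s)))
    \<le> (\<integral>\<^sup>+x. h x \<partial>lborel)"
proof -
  obtain \<phi> a x0 where \<phi>[measurable]: "\<phi> \<in> borel_measurable lborel" and \<phi>f: "\<And>x. \<phi> x \<le> f x" and a: "0 < a"
    and x0: "\<phi> x0 = ennreal a" and \<phi>a: "\<And>x. \<phi> x \<le> ennreal a" and r: "ennreal r < (\<integral>\<^sup>+x. \<phi> x \<partial>lborel)"
    using nn_integral_less_simple_attaining_max[OF _ rq(3)] by (auto simp: space_lborel)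
  obtain \<psi> b y0 where \<psi>[measurable]: "\<psi> \<in> borel_measurable lborel" and \<psi>g: "\<And>x. \<psi> x \<le> g x" and b: "0 < b"
    and y0: "\<psi> y0 = ennreal b" and \<psi>b: "\<And>x. \<psi> x \<le> ennreal b" and q: "ennreal q < (\<integral>\<^sup>+x. \<psi> x \<partial>lborel)"
    using nn_integral_less_simple_attaining_max[OF _ rq(4)] by (auto simp: space_lborel)
  \<comment> \<open>Since the exponents add up to 1, levels \<open>a * u\<close> and
    \<open>b * u\<close> combine to exactly \<open>m * u\<close>.\<close>
  define m where "m = k * (a powr s * b powr (1 - s))"
  have m: "0 < m" using a b pos by (simp add: m_def)
  define X where "X = (\<integral>\<^sup>+u\<in>{0<..<1}. emeasure lborel {x\<in>space lborel. ennreal (a * u) \<le> \<phi> x} \<partial>lborel)"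
  define Y where "Y = (\<integral>\<^sup>+u\<in>{0<..<1}. emeasure lborel {x\<in>space lborel. ennreal (b * u) \<le> \<psi> x} \<partial>lborel)"
  have aX: "ennreal a * X = (\<integral>\<^sup>+x. \<phi> x \<partial>lborel)"
    unfolding X_def using \<phi>a a by (subst layer_cake[symmetric]) (auto simp: min_absorb1 lborel.sigma_finite_measure_axioms)
  have bY: "ennreal b * Y = (\<integral>\<^sup>+x. \<psi> x \<partial>lborel)"
    unfolding Y_def using \<psi>b b by (subst layer_cake[symmetric]) (auto simp: min_absorb1 lborel.sigma_finite_measure_axioms)
  have X: "ennreal (r / a) \<le> X"
  proof -
    have "ennreal a * ennreal (r / a) \<le> ennreal a * X"
      unfolding aX using r a rq by (simp flip: ennreal_mult')
    then show ?thesis using a by (subst (asm) ennreal_mult_le_mult_iff) auto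
  qed
  have Y: "ennreal (q / b) \<le> Y"
  proof -
    have "ennreal b * ennreal (q / b) \<le> ennreal b * Y"
      unfolding bY using q b rq by (simp flip: ennreal_mult')
    then show ?thesis using b by (subst (asm) ennreal_mult_le_mult_iff) auto
  qed
  have level: "ennreal c * emeasure lborel {x\<in>space lborel. ennreal (a * u) \<le> \<phi> x}
      + ennreal d * emeasure lborel {x\<in>space lborel. ennreal (b * u) \<le> \<psi> x}
      \<le> emeasure lborel {x\<in>space lborel. ennreal (m * u) \<le> h x}" if u: "u \<in> {0<..<1}" for u
  proof (rule brunn_minkowski_real)
    show "{x \<in> space lborel. ennreal (a * u) \<le> \<phi> x} \<noteq> {}"
      using x0 a u by (auto intro!: exI[of _ x0] ennreal_leI)
    show "{x \<in> space lborel. ennreal (b * u) \<le> \<psi> x} \<noteq> {}"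
      using y0 b u by (auto intro!: exI[of _ y0] ennreal_leI)
    fix x y assume "x \<in> {x \<in> space lborel. ennreal (a * u) \<le> \<phi> x}" "y \<in> {x \<in> space lborel. ennreal (b * u) \<le> \<psi> x}"
    then have "ennreal (k * ((a * u) powr s * (b * u) powr (1 - s))) \<le> h (c * x + d * y)"
      using a b u by (intro H) (auto intro: order_trans \<phi>f \<psi>g)
    also have "k * ((a * u) powr s * (b * u) powr (1 - s)) = m * (u powr s * u powr (1 - s))"
      using a b u by (simp add: m_def powr_mult)
    also have "u powr s * u powr (1 - s) = u"
      using u by (simp flip: powr_add)
    finally show "c * x + d * y \<in> {x \<in> space lborel. ennreal (m * u) \<le> h x}" by simp
  qed (use pos in \<open>simp_all del: space_lborel\<close>)
  have e: "(c * r / (s * a)) powr s = (c / s) powr s * r powr s / a powr s"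
      "(d * q / ((1 - s) * b)) powr (1 - s) = (d / (1 - s)) powr (1 - s) * q powr (1 - s) / b powr (1 - s)"
    using pos rq a b by (simp_all add: powr_mult powr_divide del: left_diff_distrib' right_diff_distrib')
  have "k * ((c / s) powr s * (d / (1 - s)) powr (1 - s)) * (r powr s * q powr (1 - s))
      = m * ((c * r / (s * a)) powr s * (d * q / ((1 - s) * b)) powr (1 - s))"
    using a b by (simp add: m_def e)
  \<comment> \<open>Weighted AM-GM; dividing by \<open>s\<close> and \<open>1 - s\<close> beforehand
    makes the arithmetic mean equal to the sum that Brunn-Minkowski bounds.\<close>
  also have "\<dots> \<le> m * (s * (c * r / (s * a)) + (1 - s) * (d * q / ((1 - s) * b)))"
    using pos rq a b m by (intro mult_left_mono Youngs_inequality_0) auto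
  also have "s * (c * r / (s * a)) + (1 - s) * (d * q / ((1 - s) * b)) = c * (r / a) + d * (q / b)"
    using pos by simp
  finally have "ennreal (k * ((c / s) powr s * (d / (1 - s)) powr (1 - s)) * (r powr s * q powr (1 - s)))
      \<le> ennreal (m * (c * (r / a) + d * (q / b)))"
    by (rule ennreal_leI)
  also have "\<dots> = ennreal m * (ennreal c * ennreal (r / a) + ennreal d * ennreal (q / b))"
    using pos rq a b m by (simp add: ennreal_mult ennreal_plus del: times_divide_eq_right)
  also have "\<dots> \<le> ennreal m * (ennreal c * X + ennreal d * Y)"
    by (intro mult_left_mono add_mono X Y) auto
  also have "ennreal c * X + ennreal d * Y = (\<integral>\<^sup>+u\<in>{0<..<1}.
      (ennreal c * emeasure lborel {x\<in>space lborel. ennreal (a * u) \<le> \<phi> x}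
      + ennreal d * emeasure lborel {x\<in>space lborel. ennreal (b * u) \<le> \<psi> x}) \<partial>lborel)"
    unfolding X_def Y_def
    by (simp add: nn_integral_add nn_integral_cmult distrib_right mult.assoc)
  also have "\<dots> \<le> (\<integral>\<^sup>+u\<in>{0<..<1}. emeasure lborel {x\<in>space lborel. ennreal (m * u) \<le> h x} \<partial>lborel)"
    by (intro nn_integral_mono) (auto simp: indicator_def simp del: space_lborel intro: level)
  also have "ennreal m * \<dots> = (\<integral>\<^sup>+x. min (h x) (ennreal m) \<partial>lborel)"
    using m by (intro layer_cake[symmetric]) (auto simp: lborel.sigma_finite_measure_axioms)
  also have "\<dots> \<le> (\<integral>\<^sup>+x. h x \<partial>lborel)"
    by (intro nn_integral_mono) simp
  finally show ?thesis by (simp add: mult_left_mono)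
qed

text \<open>Quantifying over real lower bounds \<^term>\<open>r\<close>, \<^term>\<open>q\<close> gives a meaning to the geometric mean of
  two extended reals, and makes hypothesis and conclusion have the same shape, so that the
  inequality can be iterated over the coordinates.\<close>
lemma prekopa_leindler_real:
  fixes f g h :: "real \<Rightarrow> ennreal"
  assumes meas: "h \<in> borel_measurable borel"
    and pos: "0 < c" "0 < d" "0 < s" "s < 1" "0 < k"
    and H: "\<And>x y r q. 0 < r \<Longrightarrow> 0 < q \<Longrightarrow> ennreal r \<le> f x \<Longrightarrow> ennreal q \<le> g y \<Longrightarrow>
      ennreal (k * (r powr s * q powr (1 - s))) \<le> h (c * x + d * y)"
    and rq: "0 < r" "0 < q" "ennreal r \<le> (\<integral>\<^sup>+x. f x \<partial>lborel)" "ennreal q \<le> (\<integral>\<^sup>+x. g x \<partial>lborel)"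
  shows "ennreal (k * ((c / s) powr s * (d / (1 - s)) powr (1 - s)) * (r powr s * q powr (1 - s)))
    \<le> (\<integral>\<^sup>+x. h x \<partial>lborel)" (is "ennreal ?L \<le> ?R")
proof (cases ?R)
  case (real v)
  \<comment> \<open>The auxiliary version wants \<open>r\<close> and \<open>q\<close> strictly below
    the integrals. Its bound is homogeneous of degree 1 in the pair, so shrinking both by \<theta>
    costs one factor \<theta>, which then tends to 1.\<close>
  have "\<theta> * ?L \<le> v" if \<theta>: "0 < \<theta>" "\<theta> < 1" for \<theta>
  proof -
    have "ennreal (\<theta> * r) < ennreal r" "ennreal (\<theta> * q) < ennreal q"
      using \<theta> rq by (auto intro!: ennreal_lessI)
    then have "ennreal (k * ((c / s) powr s * (d / (1 - s)) powr (1 - s)) * ((\<theta> * r) powr s * (\<theta> * q) powr (1 - s))) \<le> ?R"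
      using \<theta> rq by (intro prekopa_leindler_real_aux[OF meas pos H]) auto
    also have "(\<theta> * r) powr s * (\<theta> * q) powr (1 - s) = (\<theta> powr s * \<theta> powr (1 - s)) * (r powr s * q powr (1 - s))"
      using \<theta> rq by (simp add: powr_mult)
    also have "\<theta> powr s * \<theta> powr (1 - s) = \<theta>"
      using \<theta> by (simp flip: powr_add)
    finally show ?thesis
      using real by (simp add: mult_ac)
  qed
  then have "?L \<le> v" by (rule field_le_mult_one_interval)
  then show ?thesis using real by (simp add: ennreal_leI)
qed simp

section \<open>Passage to several dimensions\<close>

text \<open>Induction on the coordinates. Freezing the new coordinate at \<open>u\<close>,
  \<open>v\<close> and \<open>c * u + d * v\<close>, the induction hypothesis for the slices says
  that the marginals in that coordinate satisfy the hypothesis of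
  \<open>prekopa_leindler_real\<close>, with \<open>k\<close> the factor from the earlier
  coordinates.\<close>

lemma prekopa_leindler_PiM:
  fixes f g h :: "('i \<Rightarrow> real) \<Rightarrow> ennreal"
  assumes fin: "finite I"
    and pos: "0 < c" "0 < d" "0 < s" "s < 1"
    and meas: "f \<in> borel_measurable (\<Pi>\<^sub>M i\<in>I. lborel)" "g \<in> borel_measurable (\<Pi>\<^sub>M i\<in>I. lborel)"
      "h \<in> borel_measurable (\<Pi>\<^sub>M i\<in>I. lborel)"
    and H: "\<And>x y r q. x \<in> extensional I \<Longrightarrow> y \<in> extensional I \<Longrightarrow> 0 < r \<Longrightarrow> 0 < q \<Longrightarrow>
      ennreal r \<le> f x \<Longrightarrow> ennreal q \<le> g y \<Longrightarrow>
      ennreal (r powr s * q powr (1 - s)) \<le> h (\<lambda>i\<in>I. c * x i + d * y i)"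
    and rq: "0 < r" "0 < q"
      "ennreal r \<le> (\<integral>\<^sup>+x. f x \<partial>(\<Pi>\<^sub>M i\<in>I. lborel))" "ennreal q \<le> (\<integral>\<^sup>+x. g x \<partial>(\<Pi>\<^sub>M i\<in>I. lborel))"
  shows "ennreal (((c / s) powr s * (d / (1 - s)) powr (1 - s)) ^ card I * (r powr s * q powr (1 - s)))
    \<le> (\<integral>\<^sup>+x. h x \<partial>(\<Pi>\<^sub>M i\<in>I. lborel))"
  using fin meas H rq
proof (induction I arbitrary: f g h r q rule: finite_induct)
  case empty
  interpret product_sigma_finite "\<lambda>_::'i. lborel :: real measure" ..
  from empty show ?case
    by (simp add: PiM_empty nn_integral_count_space_finite restrict_def)
next
  case (insert i I)
  interpret product_sigma_finite "\<lambda>_::'i. lborel :: real measure" ..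
  interpret fin: finite_product_sigma_finite "\<lambda>_::'i. lborel :: real measure" I
    by standard fact
  note [measurable] = insert.prems(1-3)
  note ins = product_nn_integral_insert_rev[OF insert.hyps(1,2)]
  have slice: "(\<lambda>x. w (x(i := u))) \<in> borel_measurable (\<Pi>\<^sub>M i\<in>I. lborel)"
    if [measurable]: "w \<in> borel_measurable (\<Pi>\<^sub>M i\<in>insert i I. lborel)" for w :: "('i \<Rightarrow> real) \<Rightarrow> ennreal" and u
    by measurable
  let ?k = "((c / s) powr s * (d / (1 - s)) powr (1 - s))"
  have "ennreal (?k ^ card I * ?k * (r powr s * q powr (1 - s)))
      \<le> (\<integral>\<^sup>+w. (\<integral>\<^sup>+x. h (x(i := w)) \<partial>(\<Pi>\<^sub>M i\<in>I. lborel)) \<partial>lborel)"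
  proof (rule prekopa_leindler_real[where f="\<lambda>u. \<integral>\<^sup>+x. f (x(i := u)) \<partial>(\<Pi>\<^sub>M i\<in>I. lborel)"
        and g="\<lambda>u. \<integral>\<^sup>+x. g (x(i := u)) \<partial>(\<Pi>\<^sub>M i\<in>I. lborel)"])
    show "(\<lambda>w. \<integral>\<^sup>+x. h (x(i := w)) \<partial>(\<Pi>\<^sub>M i\<in>I. lborel)) \<in> borel_measurable borel"
      by measurable
    fix u v r q :: real
    assume rq: "0 < r" "0 < q" "ennreal r \<le> (\<integral>\<^sup>+x. f (x(i := u)) \<partial>(\<Pi>\<^sub>M i\<in>I. lborel))"
      "ennreal q \<le> (\<integral>\<^sup>+x. g (x(i := v)) \<partial>(\<Pi>\<^sub>M i\<in>I. lborel))"
    show "ennreal (?k ^ card I * (r powr s * q powr (1 - s)))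
        \<le> (\<integral>\<^sup>+x. h (x(i := c * u + d * v)) \<partial>(\<Pi>\<^sub>M i\<in>I. lborel))"
    proof (rule insert.IH[OF _ _ _ _ rq])
      fix x y :: "'i \<Rightarrow> real" and r q :: real
      assume xy: "x \<in> extensional I" "y \<in> extensional I"
        and rq: "0 < r" "0 < q" "ennreal r \<le> f (x(i := u))" "ennreal q \<le> g (y(i := v))"
      have "x(i := u) \<in> extensional (insert i I)" "y(i := v) \<in> extensional (insert i I)"
        using xy by (auto simp: extensional_def)
      from insert.prems(4)[OF this rq]
      have "ennreal (r powr s * q powr (1 - s))
          \<le> h (\<lambda>j\<in>insert i I. c * (x(i := u)) j + d * (y(i := v)) j)" .
      also have "(\<lambda>j\<in>insert i I. c * (x(i := u)) j + d * (y(i := v)) j)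
          = (\<lambda>j\<in>I. c * x j + d * y j)(i := c * u + d * v)"
        using insert.hyps(2) by (auto simp: fun_eq_iff)
      finally show "ennreal (r powr s * q powr (1 - s)) \<le> h ((\<lambda>j\<in>I. c * x j + d * y j)(i := c * u + d * v))" .
    qed (intro slice insert.prems)+
  qed (use pos insert.prems in \<open>simp_all add: ins\<close>)
  then show ?case
    using insert.hyps insert.prems by (simp add: ins mult_ac)
qed

text \<open>The linear map \<open>T\<close> carries the product measure to \<open>lborel\<close> and
  respects the combination of points. The weight \<open>s\<close> stays free, so that it can be
  optimised in the application.\<close>

lemma prekopa_leindler:
  fixes f g h :: "'a :: euclidean_space \<Rightarrow> ennreal"
  assumes pos: "0 < c" "0 < d" "0 < s" "s < 1"
    and [measurable]: "f \<in> borel_measurable borel" "g \<in> borel_measurable borel" "h \<in> borel_measurable borel"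
    and H: "\<And>x y r q. 0 < r \<Longrightarrow> 0 < q \<Longrightarrow> ennreal r \<le> f x \<Longrightarrow> ennreal q \<le> g y \<Longrightarrow>
      ennreal (r powr s * q powr (1 - s)) \<le> h (c *\<^sub>R x + d *\<^sub>R y)"
    and rq: "0 < r" "0 < q" "ennreal r \<le> (\<integral>\<^sup>+x. f x \<partial>lborel)" "ennreal q \<le> (\<integral>\<^sup>+x. g x \<partial>lborel)"
  shows "ennreal (((c / s) powr s * (d / (1 - s)) powr (1 - s)) ^ DIM('a) * (r powr s * q powr (1 - s)))
    \<le> (\<integral>\<^sup>+x. h x \<partial>lborel)"
proof -
  define T :: "('a \<Rightarrow> real) \<Rightarrow> 'a" where "T x = (\<Sum>b\<in>Basis. x b *\<^sub>R b)" for x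
  have T[measurable]: "T \<in> (\<Pi>\<^sub>M b\<in>Basis. lborel) \<rightarrow>\<^sub>M borel"
    unfolding T_def[abs_def] by measurable
  have lb: "lborel = distr (\<Pi>\<^sub>M b\<in>Basis. lborel) borel T"
    unfolding T_def[abs_def] by (rule lborel_eq)
  have int: "(\<integral>\<^sup>+x. w x \<partial>lborel) = (\<integral>\<^sup>+x. w (T x) \<partial>(\<Pi>\<^sub>M b\<in>Basis. lborel))"
    if [measurable]: "w \<in> borel_measurable borel" for w :: "'a \<Rightarrow> ennreal"
    by (subst lb, subst nn_integral_distr) auto
  have lin: "T (\<lambda>i\<in>Basis. c * x i + d * y i) = c *\<^sub>R T x + d *\<^sub>R T y" for x y
    by (simp add: T_def scaleR_add_left sum.distrib scaleR_sum_right)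
  show ?thesis
    unfolding int[OF assms(7)]
  proof (rule prekopa_leindler_PiM[where f="\<lambda>x. f (T x)" and g="\<lambda>x. g (T x)"])
    fix x y r q
    assume "0 < r" "0 < q" "ennreal r \<le> f (T x)" "ennreal q \<le> g (T y)"
    then show "ennreal (r powr s * q powr (1 - s)) \<le> h (T (\<lambda>i\<in>Basis. c * x i + d * y i))"
      unfolding lin by (rule H)
  qed (use pos rq in \<open>simp_all flip: int\<close>)
qed

section \<open>Gaussian integrals\<close>

text \<open>The second derivative of the negated function is
  \<open>(1 - x\<^sup>2) * exp (- (x\<^sup>2 / 2))\<close>, which is nonnegative on [0,1]. This is
  where the bound 1 on \<open>x\<close> and \<open>y\<close> is spent.\<close>

lemma exp_neg_half_square_concave:
  fixes x y t :: real
  assumes "0 \<le> x" "x \<le> 1" "0 \<le> y" "y \<le> 1" "0 \<le> t" "t \<le> 1"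
  shows "t * exp (- (x\<^sup>2 / 2)) + (1 - t) * exp (- (y\<^sup>2 / 2)) \<le> exp (- ((t * x + (1 - t) * y)\<^sup>2 / 2))"
proof -
  have "convex_on {0..1} (\<lambda>x::real. - exp (- (x\<^sup>2 / 2)))"
  proof (rule f''_ge0_imp_convex)
    show "((\<lambda>x::real. - exp (- (x\<^sup>2 / 2))) has_real_derivative x * exp (- (x\<^sup>2 / 2))) (at x)" for x
      by (auto intro!: derivative_eq_intros)
    show "((\<lambda>x. x * exp (- (x\<^sup>2 / 2))) has_real_derivative (1 - x\<^sup>2) * exp (- (x\<^sup>2 / 2))) (at x)" for x :: real
      by (auto intro!: derivative_eq_intros simp: algebra_simps power2_eq_square)
    show "0 \<le> (1 - x\<^sup>2) * exp (- (x\<^sup>2 / 2))" if "x \<in> {0..1}" for x :: real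
      using that by (simp add: power_le_one)
  qed auto
  from convex_onD[OF this, of "1 - t" x y] assms show ?thesis
    by (simp add: algebra_simps)
qed

lemma square_mean_le_weighted:
  fixes x y t p q :: real
  assumes "0 \<le> x" "x \<le> 1" "0 \<le> y" "y \<le> 1" "0 \<le> t" "t \<le> 1"
  shows "(t * p + (1 - t) * q)\<^sup>2
    \<le> (t * (p\<^sup>2 * exp (x\<^sup>2 / 2)) + (1 - t) * (q\<^sup>2 * exp (y\<^sup>2 / 2))) * exp (- ((t * x + (1 - t) * y)\<^sup>2 / 2))"
proof -
  define X Y where "X = exp (x\<^sup>2 / 2)" and "Y = exp (y\<^sup>2 / 2)"
  have XY: "0 < X" "0 < Y" by (simp_all add: X_def Y_def)
  \<comment> \<open>Cauchy-Schwarz with its defect written out as a square.\<close>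
  have "(t * (p\<^sup>2 * X) + (1 - t) * (q\<^sup>2 * Y)) * (t * (1 / X) + (1 - t) * (1 / Y)) - (t * p + (1 - t) * q)\<^sup>2
      = t * (1 - t) * (p * X - q * Y)\<^sup>2 / (X * Y)"
    using XY by (simp add: field_simps power2_eq_square)
  also have "\<dots> \<ge> 0" using assms XY by simp
  finally have "(t * p + (1 - t) * q)\<^sup>2
      \<le> (t * (p\<^sup>2 * X) + (1 - t) * (q\<^sup>2 * Y)) * (t * (1 / X) + (1 - t) * (1 / Y))" by simp
  also have "\<dots> \<le> (t * (p\<^sup>2 * X) + (1 - t) * (q\<^sup>2 * Y)) * exp (- ((t * x + (1 - t) * y)\<^sup>2 / 2))"
    using exp_neg_half_square_concave[OF assms] XY assms
    by (intro mult_left_mono) (simp_all add: X_def Y_def exp_minus inverse_eq_divide)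
  finally show ?thesis by (simp add: X_def Y_def)
qed

section \<open>Integrability of Gaussian weights\<close>

lemma integrable_exp_neg_norm_square:
  assumes "0 < A"
  shows "integrable lborel (\<lambda>x::'a::euclidean_space. exp (- (A * (norm x)\<^sup>2 / 2)))"
proof -
  have 1: "integrable lborel (\<lambda>x::real. exp (- (A * x\<^sup>2 / 2)))"
  proof -
    have "0 < 1 / sqrt A" using assms by simp
    \<comment> \<open>The weight is the normal density of standard deviation
      \<open>1 / sqrt A\<close> with its normalising factor cleared.\<close>
    then have "integrable lborel (\<lambda>x. sqrt (2 * pi / A) * normal_density 0 (1 / sqrt A) x)"
      by (intro integrable_mult_right integrable_normal_density)
    also have "(\<lambda>x. sqrt (2 * pi / A) * normal_density 0 (1 / sqrt A) x) = (\<lambda>x. exp (- (A * x\<^sup>2 / 2)))"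
      using assms by (auto simp: normal_density_def fun_eq_iff power_divide real_sqrt_divide real_sqrt_mult)
    finally show ?thesis .
  qed
  have "(\<integral>\<^sup>+(x::'a). ennreal (exp (- (A * (norm x)\<^sup>2 / 2))) \<partial>lborel)
      = (\<integral>\<^sup>+(x::'a). (\<Prod>b\<in>Basis. ennreal (exp (- (A * (x \<bullet> b)\<^sup>2 / 2)))) \<partial>lborel)"
  proof (intro nn_integral_cong)
    fix x :: 'a
    have "- (A * (norm x)\<^sup>2 / 2) = (\<Sum>b\<in>Basis. - (A * (x \<bullet> b)\<^sup>2 / 2))"
      unfolding power2_norm_eq_inner euclidean_inner[of x x]
      by (simp add: sum_distrib_left sum_divide_distrib sum_negf power2_eq_square)
    then show "ennreal (exp (- (A * (norm x)\<^sup>2 / 2))) = (\<Prod>b\<in>Basis. ennreal (exp (- (A * (x \<bullet> b)\<^sup>2 / 2))))"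
      by (simp add: exp_sum prod_ennreal)
  qed
  also have "\<dots> = (\<Prod>b\<in>(Basis::'a set). \<integral>\<^sup>+x. ennreal (exp (- (A * x\<^sup>2 / 2))) \<partial>lborel)"
    by (rule nn_integral_lborel_prod) auto
  also have "\<dots> < \<infinity>"
    using 1 by (simp add: nn_integral_eq_integral power_less_top_ennreal)
  finally show ?thesis
    by (intro integrableI_nonneg) auto
qed

text \<open>The constant \<open>(2 * pi) powr (- n / 2)\<close> is left out: the final inequality is
  homogeneous in the measure, so it can be restored at the end.\<close>

definition gauss_int :: "real \<Rightarrow> 'a::euclidean_space set \<Rightarrow> real" where
  "gauss_int A U = (LINT x:U|lborel. exp (- (A * (norm x)\<^sup>2 / 2)))"

text \<open>Unnormalised: the mean of |x|^2 is the quotient by \<open>gauss_int 1 U\<close>.\<close>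

definition gauss_moment :: "'a::euclidean_space set \<Rightarrow> real" where
  "gauss_moment U = (LINT x:U|lborel. (norm x)\<^sup>2 * exp (- ((norm x)\<^sup>2 / 2)))"

lemma set_integrable_gauss:
  fixes U :: "'a::euclidean_space set"
  shows "U \<in> sets borel \<Longrightarrow> 0 < A \<Longrightarrow> set_integrable lborel U (\<lambda>x. exp (- (A * (norm x)\<^sup>2 / 2)))"
  by (rule set_integrable_subset[of _ UNIV])
     (simp_all add: set_integrable_def integrable_exp_neg_norm_square)

lemma set_integrable_gauss_moment:
  fixes U :: "'a::euclidean_space set"
  assumes U[measurable]: "U \<in> sets borel"
  shows "set_integrable lborel U (\<lambda>x. (norm x)\<^sup>2 * exp (- ((norm x)\<^sup>2 / 2)))"
proof (rule set_integrable_bound)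
  show "set_integrable lborel U (\<lambda>x. 4 * exp (- (1/2 * (norm x)\<^sup>2 / 2)))"
    by (intro set_integrable_mult_right set_integrable_gauss U) simp
  have "(norm x)\<^sup>2 * exp (- ((norm x)\<^sup>2 / 2)) \<le> 4 * exp (- (1/2 * (norm x)\<^sup>2 / 2))" for x :: 'a
  proof -
    \<comment> \<open>Half of the Gaussian decay absorbs the quadratic factor.\<close>
    have "(norm x)\<^sup>2 \<le> 4 * exp ((norm x)\<^sup>2 / 4)"
      using exp_ge_add_one_self[of "(norm x)\<^sup>2 / 4"] by linarith
    then have "(norm x)\<^sup>2 * exp (- ((norm x)\<^sup>2 / 2)) \<le> 4 * exp ((norm x)\<^sup>2 / 4) * exp (- ((norm x)\<^sup>2 / 2))"
      by (rule mult_right_mono) simp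
    also have "\<dots> = 4 * exp (- (1/2 * (norm x)\<^sup>2 / 2))"
      by (simp flip: exp_add)
    finally show ?thesis .
  qed
  then show "AE x in lborel. x \<in> U \<longrightarrow> norm ((norm x)\<^sup>2 * exp (- ((norm x)\<^sup>2 / 2)))
      \<le> norm (4 * exp (- (1/2 * (norm x)\<^sup>2 / 2)))"
    by simp
qed (simp add: set_borel_measurable_def)

lemma gauss_int_nonneg: "0 \<le> gauss_int A U"
  unfolding gauss_int_def set_lebesgue_integral_def by (rule Bochner_Integration.integral_nonneg) simp

section \<open>Changing the Gaussian parameter, and the second moment\<close>

text \<open>Jensen's inequality via the tangent line of the exponential at the mean \<open>v\<close>
  of |x|^2: after integration the linear term vanishes by the choice of \<open>v\<close>.\<close>

lemma gauss_int_jensen: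
  fixes U :: "'a::euclidean_space set"
  assumes U[measurable]: "U \<in> sets borel" and A: "0 < A" and pos: "0 < gauss_int 1 U"
  shows "gauss_int 1 U * exp (- ((A - 1) * (gauss_moment U / gauss_int 1 U) / 2)) \<le> gauss_int A U"
proof -
  define v where "v = gauss_moment U / gauss_int 1 U"
  define E where "E = exp (- ((A - 1) * v / 2))"
  have v: "gauss_moment U = v * gauss_int 1 U" using pos by (simp add: v_def)
  let ?e = "\<lambda>x::'a. exp (- ((norm x)\<^sup>2 / 2))"
  have i1: "set_integrable lborel U ?e" using set_integrable_gauss[OF U, of 1] by simp
  have "gauss_int 1 U * E = E * (1 + (A - 1) * v / 2) * gauss_int 1 U - E * ((A - 1) / 2) * gauss_moment U"
    unfolding v by (simp add: algebra_simps)
  also have "\<dots> = (LINT x:U|lborel. E * (1 + (A - 1) * v / 2) * ?e x - E * ((A - 1) / 2) * ((norm x)\<^sup>2 * ?e x))"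
    unfolding gauss_int_def gauss_moment_def
    by (subst set_integral_diff) (simp_all add: i1 set_integrable_gauss_moment[OF U])
  also have "\<dots> \<le> gauss_int A U"
    unfolding gauss_int_def
  proof (rule set_integral_mono)
    show "set_integrable lborel U (\<lambda>x. E * (1 + (A - 1) * v / 2) * ?e x - E * ((A - 1) / 2) * ((norm x)\<^sup>2 * ?e x))"
      by (intro set_integral_diff set_integrable_mult_right i1 set_integrable_gauss_moment[OF U])
    fix x :: 'a
    have "1 + - ((A - 1) * ((norm x)\<^sup>2 - v) / 2) \<le> exp (- ((A - 1) * ((norm x)\<^sup>2 - v) / 2))"
      by (rule exp_ge_add_one_self)
    then have "E * ?e x * (1 + - ((A - 1) * ((norm x)\<^sup>2 - v) / 2))
        \<le> E * ?e x * exp (- ((A - 1) * ((norm x)\<^sup>2 - v) / 2))"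
      by (intro mult_left_mono) (simp_all add: E_def)
    also have "\<dots> = exp (- (A * (norm x)\<^sup>2 / 2))"
      unfolding E_def by (simp flip: exp_add add: field_simps)
    also have "E * ?e x * (1 + - ((A - 1) * ((norm x)\<^sup>2 - v) / 2))
        = E * (1 + (A - 1) * v / 2) * ?e x - E * ((A - 1) / 2) * ((norm x)\<^sup>2 * ?e x)"
      by (simp add: field_simps)
    finally show "E * (1 + (A - 1) * v / 2) * ?e x - E * ((A - 1) / 2) * ((norm x)\<^sup>2 * ?e x)
        \<le> exp (- (A * (norm x)\<^sup>2 / 2))" .
  qed (rule set_integrable_gauss[OF U A])
  finally show ?thesis by (simp add: E_def v_def)
qed

text \<open>Substituting \<open>s *\<^sub>R x\<close> in the integral over \<open>W\<close> turns
  the parameter \<open>A\<close> into \<open>s\<^sup>2 * A\<close> and yields the Jacobian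
  \<open>s ^ DIM('a)\<close>.\<close>

lemma gauss_int_scale:
  fixes U :: "'a::euclidean_space set"
  assumes U[measurable]: "U \<in> sets borel" and W[measurable]: "W \<in> sets borel" and s: "0 < s" "s \<le> 1"
    and sub: "\<And>x. x \<in> U \<Longrightarrow> s *\<^sub>R x \<in> W" and A: "0 < A"
  shows "s ^ DIM('a) * gauss_int (s\<^sup>2 * A) U \<le> gauss_int A W"
proof -
  have int: "integrable lborel (\<lambda>x::'a. indicator W x *\<^sub>R exp (- (A * (norm x)\<^sup>2 / 2)))"
    using set_integrable_gauss[OF W A] by (simp add: set_integrable_def)
  have aff: "lborel = density (distr lborel borel (\<lambda>x::'a. s *\<^sub>R x)) (\<lambda>_. ennreal (s ^ DIM('a)))"
    using lborel_affine[of s "0::'a"] s by simp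
  have "gauss_int A W = (\<integral>x. indicator W x *\<^sub>R exp (- (A * (norm x)\<^sup>2 / 2))
      \<partial>density (distr lborel borel (\<lambda>x::'a. s *\<^sub>R x)) (\<lambda>_. ennreal (s ^ DIM('a))))"
    unfolding gauss_int_def set_lebesgue_integral_def by (subst aff) simp
  also have "\<dots> = (\<integral>x. s ^ DIM('a) * (indicator W (s *\<^sub>R x) * exp (- (A * (norm (s *\<^sub>R x))\<^sup>2 / 2))) \<partial>lborel)"
    using s by (subst integral_density) (auto simp: integral_distr)
  finally have eq: "gauss_int A W
      = (\<integral>x. s ^ DIM('a) * (indicator W (s *\<^sub>R x) * exp (- (A * (norm (s *\<^sub>R x))\<^sup>2 / 2))) \<partial>lborel)" .
  have "integrable (density (distr lborel borel (\<lambda>x::'a. s *\<^sub>R x)) (\<lambda>_. ennreal (s ^ DIM('a))))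
      (\<lambda>x::'a. indicator W x *\<^sub>R exp (- (A * (norm x)\<^sup>2 / 2)))"
    using int by (subst (asm) aff)
  then have int': "integrable lborel (\<lambda>x. s ^ DIM('a) * (indicator W (s *\<^sub>R x) * exp (- (A * (norm (s *\<^sub>R x))\<^sup>2 / 2))))"
    using s by (subst (asm) integrable_density) (auto simp: integrable_distr_eq)
  have "s ^ DIM('a) * gauss_int (s\<^sup>2 * A) U
      = (\<integral>x. s ^ DIM('a) * (indicator U x * exp (- (s\<^sup>2 * A * (norm x)\<^sup>2 / 2))) \<partial>lborel)"
    unfolding gauss_int_def set_lebesgue_integral_def by simp
  also have "\<dots> \<le> gauss_int A W"
    unfolding eq
  proof (rule integral_mono[OF _ int'])
    show "integrable lborel (\<lambda>x. s ^ DIM('a) * (indicator U x * exp (- (s\<^sup>2 * A * (norm x)\<^sup>2 / 2))))"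
      using set_integrable_gauss[OF U, of "s\<^sup>2 * A"] s A by (auto simp: set_integrable_def)
    show "s ^ DIM('a) * (indicator U x * exp (- (s\<^sup>2 * A * (norm x)\<^sup>2 / 2)))
        \<le> s ^ DIM('a) * (indicator W (s *\<^sub>R x) * exp (- (A * (norm (s *\<^sub>R x))\<^sup>2 / 2)))" for x
      using s sub[of x] by (auto simp: indicator_def power_mult_distrib mult_ac)
  qed
  finally show ?thesis .
qed

text \<open>Shrinking \<open>U\<close> into itself bounds
  \<open>s ^ DIM('a) * gauss_int (s\<^sup>2) U\<close> by its value at \<open>s = 1\<close>. With
  Jensen's inequality for the left factor and logarithms, this becomes a first-order condition as
  \<open>s\<close> tends to 1 from below.\<close>

lemma gauss_moment_le:
  fixes U :: "'a::euclidean_space set"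
  assumes U[measurable]: "U \<in> sets borel" and pos: "0 < gauss_int 1 U" and star: "\<And>s x. 0 < s \<Longrightarrow> s \<le> 1 \<Longrightarrow> x \<in> U \<Longrightarrow> s *\<^sub>R x \<in> U"
  shows "gauss_moment U / gauss_int 1 U \<le> real DIM('a)"
proof -
  define v where "v = gauss_moment U / gauss_int 1 U"
  have "(s * ((1 + s) / 2)) * v \<le> real DIM('a)" if s: "0 < s" "s < 1" for s
  proof -
    have "gauss_int 1 U * (s ^ DIM('a) * exp (- ((s\<^sup>2 - 1) * v / 2))) \<le> s ^ DIM('a) * gauss_int (s\<^sup>2) U"
      using gauss_int_jensen[OF U, of "s\<^sup>2"] s pos by (simp add: v_def mult_ac mult_left_mono)
    also have "\<dots> \<le> gauss_int 1 U"
      using gauss_int_scale[OF U U, of s 1] s star by simp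
    finally have "s ^ DIM('a) * exp (- ((s\<^sup>2 - 1) * v / 2)) \<le> 1"
      using pos by simp
    then have "ln (s ^ DIM('a) * exp (- ((s\<^sup>2 - 1) * v / 2))) \<le> 0"
      using s by (subst ln_le_zero_iff) auto
    also have "ln (s ^ DIM('a) * exp (- ((s\<^sup>2 - 1) * v / 2))) = real DIM('a) * ln s + (1 - s\<^sup>2) * v / 2"
      using s by (simp add: ln_mult ln_realpow field_simps)
    finally have le: "real DIM('a) * ln s + (1 - s\<^sup>2) * v / 2 \<le> 0" .
    \<comment> \<open>This bound on the logarithm exposes a factor \<open>1 - s\<close> on both
      sides, which can be cancelled before the limit.\<close>
    have "1 - 1 / s \<le> ln s"
      using ln_le_minus_one[of "1 / s"] s by (simp add: ln_div)
    then have "real DIM('a) * (1 - 1 / s) \<le> real DIM('a) * ln s"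
      by (intro mult_left_mono) auto
    with le have "(1 - s\<^sup>2) * v / 2 \<le> real DIM('a) * (1 / s - 1)"
      by (simp add: algebra_simps)
    then have "(1 - s) * ((s * ((1 + s) / 2)) * v) \<le> (1 - s) * real DIM('a)"
      using s by (simp add: field_simps power2_eq_square)
    then show ?thesis using s by simp
  qed
  then have "eventually (\<lambda>s. (s * ((1 + s) / 2)) * v \<le> real DIM('a)) (at_left 1)"
    by (auto simp: eventually_at_left_field intro!: exI[of _ 0])
  moreover have "((\<lambda>s. (s * ((1 + s) / 2)) * v) \<longlongrightarrow> (1 * ((1 + 1) / 2)) * v) (at_left (1::real))"
    by (intro tendsto_intros) simp_all
  ultimately show ?thesis
    using tendsto_upperbound by (fastforce simp: v_def)
qed

text \<open>The integrand vanishes on \<open>U\<close> at most at the origin, a null set. Positivity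
  permits dividing by the root mean squares later.\<close>

lemma gauss_moment_pos:
  fixes U :: "'a::euclidean_space set"
  assumes U[measurable]: "U \<in> sets borel" and pos: "0 < gauss_int 1 U"
  shows "0 < gauss_moment U"
proof (rule ccontr)
  assume "\<not> 0 < gauss_moment U"
  moreover have "0 \<le> gauss_moment U"
    unfolding gauss_moment_def set_lebesgue_integral_def by (rule Bochner_Integration.integral_nonneg) simp
  ultimately have "gauss_moment U = 0" by simp
  then have "(\<integral>x. indicator U x *\<^sub>R ((norm x)\<^sup>2 * exp (- ((norm x)\<^sup>2 / 2))) \<partial>lborel) = 0"
    unfolding gauss_moment_def set_lebesgue_integral_def .
  then have "AE x in lborel. indicator U x *\<^sub>R ((norm x)\<^sup>2 * exp (- ((norm x)\<^sup>2 / 2))) = 0"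
    using set_integrable_gauss_moment[OF U] unfolding set_integrable_def
    by (subst (asm) integral_nonneg_eq_0_iff_AE) auto
  moreover have "AE x in lborel. x \<noteq> (0::'a)" by (rule AE_lborel_singleton)
  ultimately have "AE x in lborel. indicator U x *\<^sub>R exp (- (1 * (norm x)\<^sup>2 / 2)) = (0::real)"
    by eventually_elim (auto simp: indicator_def split: if_splits)
  then have "gauss_int 1 U = 0"
    unfolding gauss_int_def set_lebesgue_integral_def by (rule integral_eq_zero_AE)
  with pos show False by simp
qed

text \<open>Serves the degenerate cases, where only one summand of the final inequality survives. It
  combines \<open>gauss_int_scale\<close> with two losses: \<open>s ^ (2 * n) \<le> s ^ n\<close>,
  and the growth of the weight when its parameter drops to \<open>s\<^sup>2\<close>.\<close>

lemma gauss_int_powr_ge_scale: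
  fixes U W :: "'a::euclidean_space set"
  assumes U: "U \<in> sets borel" and W: "W \<in> sets borel" and s: "0 \<le> s" "s \<le> 1"
    and sub: "\<And>x. x \<in> U \<Longrightarrow> s *\<^sub>R x \<in> W"
  shows "s * gauss_int 1 U powr (1 / (2 * real DIM('a))) \<le> gauss_int 1 W powr (1 / (2 * real DIM('a)))"
proof (cases "s = 0")
  case False
  with s have s0: "0 < s" by simp
  have "s ^ (2 * DIM('a)) * gauss_int 1 U \<le> s ^ DIM('a) * gauss_int (s\<^sup>2 * 1) U"
  proof (rule mult_mono)
    show "s ^ (2 * DIM('a)) \<le> s ^ DIM('a)" using s by (intro power_decreasing) auto
    show "gauss_int 1 U \<le> gauss_int (s\<^sup>2 * 1) U"
      unfolding gauss_int_def
    proof (rule set_integral_mono[OF set_integrable_gauss[OF U] set_integrable_gauss[OF U]])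
      fix x :: 'a
      have "s\<^sup>2 * (norm x)\<^sup>2 \<le> 1 * (norm x)\<^sup>2"
        using s by (intro mult_right_mono power_le_one) auto
      then show "exp (- (1 * (norm x)\<^sup>2 / 2)) \<le> exp (- (s\<^sup>2 * 1 * (norm x)\<^sup>2 / 2))" by simp
    qed (use s0 in simp_all)
  qed (use s in \<open>auto simp: gauss_int_nonneg\<close>)
  also have "\<dots> \<le> gauss_int 1 W"
    using gauss_int_scale[OF U W s0 s(2) sub, of 1] by simp
  finally have "(s ^ (2 * DIM('a)) * gauss_int 1 U) powr (1 / (2 * real DIM('a)))
      \<le> gauss_int 1 W powr (1 / (2 * real DIM('a)))"
    using s by (intro powr_mono2) (auto simp: gauss_int_nonneg)
  moreover have "(s ^ (2 * DIM('a))) powr (1 / (2 * real DIM('a))) = s"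
    using s0 by (simp add: powr_powr flip: powr_realpow)
  ultimately show ?thesis
    using s by (simp add: powr_mult gauss_int_nonneg)
qed simp

section \<open>The inequality for Borel sets closed under shrinking\<close>

text \<open>Triangle inequality, then Cauchy-Schwarz with the weights \<open>x\<close> and
  \<open>y\<close>; the defect is again a square. The right side depends only on the ratio of
  \<open>x\<close> and \<open>y\<close>.\<close>

lemma square_norm_mean_le:
  fixes X Y :: "'a::real_normed_vector"
  assumes "0 < x" "0 < y" "0 \<le> t" "t \<le> 1"
  shows "(norm (t *\<^sub>R X + (1 - t) *\<^sub>R Y))\<^sup>2
    \<le> (t * x + (1 - t) * y) * (t * (norm X)\<^sup>2 / x + (1 - t) * (norm Y)\<^sup>2 / y)"
proof -
  have "norm (t *\<^sub>R X + (1 - t) *\<^sub>R Y) \<le> t * norm X + (1 - t) * norm Y"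
    using norm_triangle_ineq[of "t *\<^sub>R X" "(1 - t) *\<^sub>R Y"] assms by simp
  then have "(norm (t *\<^sub>R X + (1 - t) *\<^sub>R Y))\<^sup>2 \<le> (t * norm X + (1 - t) * norm Y)\<^sup>2"
    by (intro power_mono) auto
  also have "(t * x + (1 - t) * y) * (t * (norm X)\<^sup>2 / x + (1 - t) * (norm Y)\<^sup>2 / y) - (t * norm X + (1 - t) * norm Y)\<^sup>2
      = t * (1 - t) * (y * norm X - x * norm Y)\<^sup>2 / (x * y)"
    using assms by (simp add: field_simps power2_eq_square)
  then have "(t * norm X + (1 - t) * norm Y)\<^sup>2
      \<le> (t * x + (1 - t) * y) * (t * (norm X)\<^sup>2 / x + (1 - t) * (norm Y)\<^sup>2 / y)"
    using assms by (smt (verit) divide_nonneg_pos mult_nonneg_nonneg mult_pos_pos zero_le_power2)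
  finally show ?thesis .
qed

text \<open>\<open>A\<close> and \<open>B\<close> are chosen so that \<open>s * A\<close> and
  \<open>(1 - s) * B\<close> are the coefficients of the two squared norms in
  \<open>square_norm_mean_le\<close>. The geometric mean of the two weights is then at most the
  standard weight at the combined point.\<close>

lemma gauss_int_prekopa_leindler:
  fixes U V W :: "'a::euclidean_space set"
  assumes [measurable]: "U \<in> sets borel" "V \<in> sets borel" "W \<in> sets borel"
    and pos: "0 < t" "t < 1" "0 < s" "s < 1" "0 < x" "0 < y"
    and AB: "A = t * (t * x + (1 - t) * y) / (s * x)" "B = (1 - t) * (t * x + (1 - t) * y) / ((1 - s) * y)"
    and gpos: "0 < gauss_int A U" "0 < gauss_int B V"
    and sub: "\<And>X Y. X \<in> U \<Longrightarrow> Y \<in> V \<Longrightarrow> t *\<^sub>R X + (1 - t) *\<^sub>R Y \<in> W"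
  shows "((t / s) powr s * ((1 - t) / (1 - s)) powr (1 - s)) ^ DIM('a)
    * (gauss_int A U powr s * gauss_int B V powr (1 - s)) \<le> gauss_int 1 W"
proof -
  let ?f = "\<lambda>A U (X::'a). ennreal (indicator U X * exp (- (A * (norm X)\<^sup>2 / 2)))"
  have AB0: "0 < A" "0 < B" using pos by (simp_all add: AB add_pos_pos)
  have int: "(\<integral>\<^sup>+X. ?f A U X \<partial>lborel) = ennreal (gauss_int A U)" if "U \<in> sets borel" "0 < A" for U A
    using set_integrable_gauss[OF that]
    unfolding gauss_int_def set_lebesgue_integral_def set_integrable_def
    by (subst nn_integral_eq_integral) auto
  have "ennreal (((t / s) powr s * ((1 - t) / (1 - s)) powr (1 - s)) ^ DIM('a)
      * (gauss_int A U powr s * gauss_int B V powr (1 - s))) \<le> (\<integral>\<^sup>+X. ?f 1 W X \<partial>lborel)"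
  proof (rule prekopa_leindler[where f="?f A U" and g="?f B V"])
    fix X Y :: 'a and r q :: real
    assume rq: "0 < r" "0 < q" "ennreal r \<le> ?f A U X" "ennreal q \<le> ?f B V Y"
    have XY: "X \<in> U" "Y \<in> V"
      by (rule ccontr; use rq in simp)+
    with rq have le: "r \<le> exp (- (A * (norm X)\<^sup>2 / 2))" "q \<le> exp (- (B * (norm Y)\<^sup>2 / 2))"
      by simp_all
    have "r powr s * q powr (1 - s)
        \<le> exp (- (A * (norm X)\<^sup>2 / 2)) powr s * exp (- (B * (norm Y)\<^sup>2 / 2)) powr (1 - s)"
      using le rq pos by (intro mult_mono powr_mono2) auto
    also have "\<dots> = exp (- ((s * A * (norm X)\<^sup>2 + (1 - s) * B * (norm Y)\<^sup>2) / 2))"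
      by (simp add: powr_def field_simps flip: exp_add)
    also have "s * A * (norm X)\<^sup>2 + (1 - s) * B * (norm Y)\<^sup>2
        = (t * x + (1 - t) * y) * (t * (norm X)\<^sup>2 / x + (1 - t) * (norm Y)\<^sup>2 / y)"
    proof -
      define m where "m = t * x + (1 - t) * y"
      have "s * A = t * m / x" "(1 - s) * B = (1 - t) * m / y"
        using pos by (simp_all add: AB flip: m_def)
      then have "s * A * (norm X)\<^sup>2 + (1 - s) * B * (norm Y)\<^sup>2
          = t * m / x * (norm X)\<^sup>2 + (1 - t) * m / y * (norm Y)\<^sup>2"
        by (simp only:)
      also have "\<dots> = m * (t * (norm X)\<^sup>2 / x + (1 - t) * (norm Y)\<^sup>2 / y)"
        by (simp add: distrib_left mult_ac)
      finally show ?thesis by (simp only: m_def)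
    qed
    also have "exp (- (\<dots> / 2)) \<le> exp (- ((norm (t *\<^sub>R X + (1 - t) *\<^sub>R Y))\<^sup>2 / 2))"
      using square_norm_mean_le[of x y t X Y] pos by simp
    finally show "ennreal (r powr s * q powr (1 - s)) \<le> ?f 1 W (t *\<^sub>R X + (1 - t) *\<^sub>R Y)"
      using sub[OF XY] by (simp add: ennreal_leI)
  qed (use pos gpos AB0 in \<open>simp_all add: int\<close>)
  also have "(\<integral>\<^sup>+X. ?f 1 W X \<partial>lborel) = ennreal (gauss_int 1 W)"
    by (rule int) simp_all
  finally show ?thesis
    by (simp add: gauss_int_nonneg)
qed

lemma gauss_int_brunn_minkowski:
  fixes U V W :: "'a::euclidean_space set"
  assumes meas: "U \<in> sets borel" "V \<in> sets borel" "W \<in> sets borel"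
    and t: "0 < t" "t < 1"
    and pos: "0 < gauss_int 1 U" "0 < gauss_int 1 V"
    and starU: "\<And>s x. 0 < s \<Longrightarrow> s \<le> 1 \<Longrightarrow> x \<in> U \<Longrightarrow> s *\<^sub>R x \<in> U"
    and starV: "\<And>s x. 0 < s \<Longrightarrow> s \<le> 1 \<Longrightarrow> x \<in> V \<Longrightarrow> s *\<^sub>R x \<in> V"
    and sub: "\<And>X Y. X \<in> U \<Longrightarrow> Y \<in> V \<Longrightarrow> t *\<^sub>R X + (1 - t) *\<^sub>R Y \<in> W"
  shows "t * gauss_int 1 U powr (1 / (2 * real DIM('a))) + (1 - t) * gauss_int 1 V powr (1 / (2 * real DIM('a)))
    \<le> gauss_int 1 W powr (1 / (2 * real DIM('a)))"
proof -
  define n where "n = DIM('a)"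
  have n: "0 < n" by (simp add: n_def)
  \<comment> \<open>Root mean squares divided by the square root of \<open>n\<close>, so that
    \<open>gauss_moment_le\<close> becomes \<open>x \<le> 1\<close> and
    \<open>y \<le> 1\<close>.\<close>
  define x where "x = sqrt (gauss_moment U / gauss_int 1 U / real n)"
  define y where "y = sqrt (gauss_moment V / gauss_int 1 V / real n)"
  have xy: "0 < x" "x \<le> 1" "0 < y" "y \<le> 1"
    using gauss_moment_le[OF meas(1) pos(1) starU] gauss_moment_le[OF meas(2) pos(2) starV]
      gauss_moment_pos[OF meas(1) pos(1)] gauss_moment_pos[OF meas(2) pos(2)] pos n
    by (simp_all add: x_def y_def n_def pos_divide_le_eq mult.commute)
  have x2: "gauss_moment U / gauss_int 1 U = real n * x\<^sup>2" and y2: "gauss_moment V / gauss_int 1 V = real n * y\<^sup>2"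
    using xy n by (simp_all add: x_def y_def)
  define p where "p = gauss_int 1 U powr (1 / (2 * real n))"
  define q where "q = gauss_int 1 V powr (1 / (2 * real n))"
  have pq: "0 < p" "0 < q" using pos by (simp_all add: p_def q_def)
  have p2: "gauss_int 1 U = (p\<^sup>2) ^ n" and q2: "gauss_int 1 V = (q\<^sup>2) ^ n"
    using pos n pq by (simp_all add: p_def q_def powr_powr flip: power_mult powr_realpow)
  \<comment> \<open>The \<open>n\<close>-th root of Jensen's lower bound for
    \<open>gauss_int A U\<close>, without the factor that depends on \<open>A\<close>; likewise
    \<open>Q\<close>.\<close>
  define P where "P = p\<^sup>2 * exp (x\<^sup>2 / 2)"
  define Q where "Q = q\<^sup>2 * exp (y\<^sup>2 / 2)"
  have PQ: "0 < P" "0 < Q" using pq by (simp_all add: P_def Q_def)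
  define D where "D = t * P + (1 - t) * Q"
  have D: "0 < D" using PQ t by (simp add: D_def add_pos_pos)
  \<comment> \<open>The equality case of weighted AM-GM: both \<open>t * P / s\<close> and
    \<open>(1 - t) * Q / (1 - s)\<close> equal \<open>D\<close>, so their geometric mean is
    \<open>D\<close> itself.\<close>
  define s where "s = t * P / D"
  have s1: "1 - s = (1 - t) * Q / D"
    using D by (simp add: s_def D_def field_simps)
  have s0: "0 < s" using PQ t D by (simp add: s_def)
  have "0 < 1 - s" unfolding s1 using PQ t D by simp
  with s0 have s: "0 < s" "s < 1" by simp_all
  define m where "m = t * x + (1 - t) * y"
  define A where "A = t * m / (s * x)"
  define B where "B = (1 - t) * m / ((1 - s) * y)"
  have m: "0 < m" using xy t by (simp add: m_def add_pos_pos)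
  have AB: "0 < A" "0 < B" using m s xy t by (simp_all add: A_def B_def)
  have ge: "(P * exp (- (A * x\<^sup>2 / 2))) ^ n \<le> gauss_int A U" "(Q * exp (- (B * y\<^sup>2 / 2))) ^ n \<le> gauss_int B V"
  proof -
    have e: "exp (- ((a - 1) * (real n * z\<^sup>2) / 2)) = (exp (z\<^sup>2 / 2) * exp (- (a * z\<^sup>2 / 2))) ^ n" for a z :: real
      by (simp add: algebra_simps diff_divide_distrib flip: exp_of_nat_mult exp_add)
    show "(P * exp (- (A * x\<^sup>2 / 2))) ^ n \<le> gauss_int A U"
      using gauss_int_jensen[OF meas(1) AB(1) pos(1)] unfolding x2 unfolding e p2
      by (simp add: P_def power_mult_distrib mult_ac)
    show "(Q * exp (- (B * y\<^sup>2 / 2))) ^ n \<le> gauss_int B V"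
      using gauss_int_jensen[OF meas(2) AB(2) pos(2)] unfolding y2 unfolding e q2
      by (simp add: Q_def power_mult_distrib mult_ac)
  qed
  have gpos: "0 < gauss_int A U" "0 < gauss_int B V"
    using PQ by (auto intro!: less_le_trans[OF _ ge(1)] less_le_trans[OF _ ge(2)])
  let ?k = "(t / s) powr s * ((1 - t) / (1 - s)) powr (1 - s)"
  have "(t * p + (1 - t) * q)\<^sup>2 \<le> D * exp (- (m\<^sup>2 / 2))"
    using square_mean_le_weighted[of x y t p q] xy t by (simp add: D_def m_def P_def Q_def)
  also have "\<dots> = ?k * ((P * exp (- (A * x\<^sup>2 / 2))) powr s * (Q * exp (- (B * y\<^sup>2 / 2))) powr (1 - s))"
  proof -
    have "t / s = D / P" "(1 - t) / (1 - s) = D / Q"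
      unfolding s1 unfolding s_def using PQ D t by (simp_all add: field_simps)
    then have "?k * (P powr s * Q powr (1 - s)) = D powr s * D powr (1 - s)"
      using PQ D by (simp add: powr_divide)
    also have "\<dots> = D" using D by (simp flip: powr_add)
    finally have 1: "?k * (P powr s * Q powr (1 - s)) = D" .
    \<comment> \<open>The terms are \<open>t * m * x\<close> and \<open>(1 - t) * m * y\<close>, so
      the exponential factors collapse to the one in \<open>square_mean_le_weighted\<close>.\<close>
    have "s * A * x\<^sup>2 + (1 - s) * B * y\<^sup>2 = m\<^sup>2"
    proof -
      have "s * A * x\<^sup>2 = t * m * x" "(1 - s) * B * y\<^sup>2 = (1 - t) * m * y"
        using s xy by (simp_all add: A_def B_def power2_eq_square)
      then show ?thesis by (simp add: m_def power2_eq_square algebra_simps)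
    qed
    then have "exp (- (m\<^sup>2 / 2)) = exp (s * - (A * x\<^sup>2 / 2)) * exp ((1 - s) * - (B * y\<^sup>2 / 2))"
      by (simp add: field_simps flip: exp_add)
    also have "\<dots> = exp (- (A * x\<^sup>2 / 2)) powr s * exp (- (B * y\<^sup>2 / 2)) powr (1 - s)"
      by (simp add: powr_def)
    finally show ?thesis
      using PQ by (simp add: powr_mult mult_ac flip: 1)
  qed
  finally have le: "(t * p + (1 - t) * q)\<^sup>2
      \<le> ?k * ((P * exp (- (A * x\<^sup>2 / 2))) powr s * (Q * exp (- (B * y\<^sup>2 / 2))) powr (1 - s))" .
  have pw: "(a ^ n) powr b = (a powr b) ^ n" if "0 < a" for a b :: real
    using that by (simp add: powr_powr mult.commute flip: powr_realpow)
  have "(t * p + (1 - t) * q) ^ (2 * n) = ((t * p + (1 - t) * q)\<^sup>2) ^ n"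
    by (simp add: power_mult)
  also have "\<dots> \<le> (?k * ((P * exp (- (A * x\<^sup>2 / 2))) powr s * (Q * exp (- (B * y\<^sup>2 / 2))) powr (1 - s))) ^ n"
    by (rule power_mono[OF le]) simp
  also have "\<dots> = ?k ^ n * (((P * exp (- (A * x\<^sup>2 / 2))) ^ n) powr s * ((Q * exp (- (B * y\<^sup>2 / 2))) ^ n) powr (1 - s))"
    using PQ by (simp only: pw power_mult_distrib[of ?k] power_mult_distrib[of "_ powr _"] mult_pos_pos exp_gt_zero)
  also have "\<dots> \<le> ?k ^ n * (gauss_int A U powr s * gauss_int B V powr (1 - s))"
    using ge PQ s by (intro mult_left_mono mult_mono powr_mono2) auto
  also have "\<dots> \<le> gauss_int 1 W"
    unfolding n_def using t s xy gpos sub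
    by (intro gauss_int_prekopa_leindler[OF meas, where x=x and y=y]) (simp_all add: A_def B_def m_def)
  finally have "((t * p + (1 - t) * q) ^ (2 * n)) powr (1 / (2 * real n)) \<le> gauss_int 1 W powr (1 / (2 * real n))"
    using t pq by (intro powr_mono2) auto
  moreover have "0 < t * p + (1 - t) * q" using t pq by (simp add: add_pos_pos)
  ultimately show ?thesis
    using n by (simp add: powr_powr p_def q_def n_def flip: powr_realpow)
qed

section \<open>Passage to convex sets\<close>

lemma convex_minkowski_comb:
  assumes "convex K" "convex L"
  shows "convex (minkowski_comb t K L)"
proof -
  have "minkowski_comb t K L = (\<Union>x\<in>(*\<^sub>R) t ` K. \<Union>y\<in>(*\<^sub>R) (1 - t) ` L. {x + y})"
    by (auto simp: minkowski_comb_def)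
  then show ?thesis
    using convex_sums[OF convex_scaling[OF assms(1)] convex_scaling[OF assms(2)]] by simp
qed

text \<open>The frontier of a convex set is negligible, so the set may be replaced by its interior,
  which is Borel and hence within reach of the results over \<open>lborel\<close>.\<close>

lemma measure_std_gaussian_convex:
  fixes S :: "(real ^ 'n) set"
  assumes "convex S"
  shows "measure std_gaussian S = (2 * pi) powr (- real CARD('n) / 2) * gauss_int 1 (interior S)"
proof -
  define c where "c = (2 * pi) powr (- real CARD('n) / 2)"
  have c: "0 < c" by (simp add: c_def)
  let ?g = "\<lambda>x::real^'n. ennreal (c * exp (- (norm x)\<^sup>2 / 2))"
  have "S - interior S \<subseteq> frontier S"
    using closure_subset by (auto simp: frontier_def)
  then have "negligible (S - interior S)"
    using negligible_convex_frontier[OF assms] negligible_subset by blast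
  then have null: "S - interior S \<in> null_sets lebesgue"
    by (simp add: negligible_iff_null_sets)
  have "interior S \<union> (S - interior S) \<in> sets lebesgue"
    by (intro sets.Un) (use null in auto)
  moreover have "interior S \<union> (S - interior S) = S"
    using interior_subset by auto
  ultimately have S: "S \<in> sets lebesgue" by simp
  have g: "?g \<in> borel_measurable lebesgue"
    by (rule measurable_completion) measurable
  have "emeasure std_gaussian S = (\<integral>\<^sup>+x. ?g x * indicator S x \<partial>lebesgue)"
    unfolding std_gaussian_def c_def[symmetric] by (rule emeasure_density[OF g S])
  also have "\<dots> = (\<integral>\<^sup>+x. ?g x * indicator (interior S) x \<partial>lebesgue)"
  proof (rule nn_integral_cong_AE)
    show "AE x in lebesgue. ?g x * indicator S x = ?g x * indicator (interior S) x"
      by (rule AE_I'[OF null]) (use interior_subset in \<open>auto simp: indicator_def\<close>)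
  qed
  also have "\<dots> = (\<integral>\<^sup>+x. ?g x * indicator (interior S) x \<partial>lborel)"
    by (rule nn_integral_completion)
  also have "\<dots> = (\<integral>\<^sup>+x. ennreal (c * (indicator (interior S) x *\<^sub>R exp (- (1 * (norm x)\<^sup>2 / 2)))) \<partial>lborel)"
    by (intro nn_integral_cong) (auto simp: indicator_def)
  also have "\<dots> = ennreal (c * gauss_int 1 (interior S))"
    using set_integrable_gauss[of "interior S" 1] c
    unfolding gauss_int_def set_lebesgue_integral_def set_integrable_def
    by (subst nn_integral_eq_integral) auto
  finally show ?thesis
    using c by (simp add: measure_def gauss_int_nonneg c_def)
qed

lemma star_interior_convex:
  fixes K :: "'a::euclidean_space set"
  assumes "convex K" "0 \<in> K" "0 < s" "s \<le> 1" "x \<in> interior K"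
  shows "s *\<^sub>R x \<in> interior K"
proof -
  have "(*\<^sub>R) s ` interior K \<subseteq> interior K"
  proof (rule interior_maximal)
    show "(*\<^sub>R) s ` interior K \<subseteq> K"
      using convexD_alt[OF assms(1,2), of _ s] interior_subset[of K] assms(3,4) by auto
    show "open ((*\<^sub>R) s ` interior K)" using assms(3) by (intro open_scaling) auto
  qed
  then show ?thesis using assms(5) by auto
qed

text \<open>For fixed \<open>y\<close> the affine image of \<open>interior K\<close> is open and
  contained in the combination; one interior summand is enough.\<close>

lemma mem_interior_minkowski_comb:
  assumes "0 < t" "x \<in> interior K" "y \<in> L"
  shows "t *\<^sub>R x + (1 - t) *\<^sub>R y \<in> interior (minkowski_comb t K L)"
proof -
  have "(\<lambda>x. (1 - t) *\<^sub>R y + t *\<^sub>R x) ` interior K \<subseteq> interior (minkowski_comb t K L)"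
  proof (rule interior_maximal)
    show "(\<lambda>x. (1 - t) *\<^sub>R y + t *\<^sub>R x) ` interior K \<subseteq> minkowski_comb t K L"
      using assms(3) interior_subset[of K] by (force simp: minkowski_comb_def)
    show "open ((\<lambda>x. (1 - t) *\<^sub>R y + t *\<^sub>R x) ` interior K)"
      using assms(1) by (intro open_affinity) auto
  qed
  then show ?thesis using assms(2) by (auto simp: add.commute)
qed

lemma minkowski_comb_commute: "minkowski_comb t K L = minkowski_comb (1 - t) L K"
  by (auto simp: minkowski_comb_def add.commute) 

text \<open>As \<open>L\<close> contains the origin, the combination contains the scaled copy of
  \<open>K\<close>.\<close>

lemma gauss_int_minkowski_comb_ge_left:
  fixes K L :: "(real ^ 'n) set"
  assumes "0 \<in> L" "0 \<le> t" "t \<le> 1"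
  shows "t * gauss_int 1 (interior K) powr (1 / (2 * real CARD('n)))
    \<le> gauss_int 1 (interior (minkowski_comb t K L)) powr (1 / (2 * real CARD('n)))"
proof (cases "t = 0")
  case False
  then have "t *\<^sub>R x \<in> interior (minkowski_comb t K L)" if "x \<in> interior K" for x
    using mem_interior_minkowski_comb[of t x K 0 L] that assms by simp
  then show ?thesis
    using gauss_int_powr_ge_scale[of "interior K" "interior (minkowski_comb t K L)" t] assms by simp
qed simp

theorem theorem1p2:
  fixes K L :: "(real ^ 'n) set" and t :: real
  assumes "convex K" and "convex L"
    and "0 \<in> K" and "0 \<in> L"
    and "0 \<le> t" and "t \<le> 1"
  shows "measure std_gaussian (minkowski_comb t K L) powr (1 / (2 * real CARD('n)))
    \<ge> t * measure std_gaussian K powr (1 / (2 * real CARD('n)))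
      + (1 - t) * measure std_gaussian L powr (1 / (2 * real CARD('n)))"
proof -
  let ?e = "1 / (2 * real CARD('n))" and ?M = "minkowski_comb t K L"
  let ?c = "(2 * pi) powr (- real CARD('n) / 2)"
  let ?g = "\<lambda>S::(real^'n) set. gauss_int 1 (interior S) powr ?e"
  have left: "t * ?g K \<le> ?g ?M"
    using gauss_int_minkowski_comb_ge_left[of L t K] assms by simp
  have right: "(1 - t) * ?g L \<le> ?g ?M"
    using gauss_int_minkowski_comb_ge_left[of K "1 - t" L] assms
    by (simp add: minkowski_comb_commute[of t K L])
  \<comment> \<open>In the first four cases one summand is zero and \<open>left\<close> or
    \<open>right\<close> bounds the other. The last case guarantees the positive masses needed to
    normalise.\<close>
  consider "t = 0" | "t = 1" | "gauss_int 1 (interior K) = 0" | "gauss_int 1 (interior L) = 0"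
    | "0 < t" "t < 1" "0 < gauss_int 1 (interior K)" "0 < gauss_int 1 (interior L)"
    using assms(5,6) gauss_int_nonneg[of 1 "interior K"] gauss_int_nonneg[of 1 "interior L"] by linarith
  then have "t * ?g K + (1 - t) * ?g L \<le> ?g ?M"
  proof cases
    case 5
    have "t * gauss_int 1 (interior K) powr (1 / (2 * real DIM(real^'n)))
        + (1 - t) * gauss_int 1 (interior L) powr (1 / (2 * real DIM(real^'n)))
        \<le> gauss_int 1 (interior ?M) powr (1 / (2 * real DIM(real^'n)))"
      using 5 assms interior_subset[of L]
      by (intro gauss_int_brunn_minkowski star_interior_convex mem_interior_minkowski_comb) auto
    then show ?thesis by simp
  qed (use left right in simp_all)
  \<comment> \<open>Restores the normalising constant of the Gaussian density.\<close>
  then have "?c powr ?e * (t * ?g K + (1 - t) * ?g L) \<le> ?c powr ?e * ?g ?M"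
    by (rule mult_left_mono) simp
  then show ?thesis
    by (simp add: measure_std_gaussian_convex assms convex_minkowski_comb powr_mult gauss_int_nonneg
        distrib_left mult_ac del: powr_powr)
qed

end
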